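(* Let $m\ge 2$ be even, and let $r=u+v_1+\dots+v_m$. Then $\pi$ restricted to $Pin(V,q)$ is not injective. Moreover, the elements of $\ker\pi\cap Pin(V,q)$ have the form $1+\lambda r$ when $m\equiv 2 \pmod 4$, and $1+\lambda(1+r)$ when $m\equiv 0\pmod 4$, where $\lambda\in R$. When restricted to $Spin(V,q)$, however, $\pi$ is injective.
   Context: $R=\mathbb{F}_2[s,s^{-1}]$ with $s$ an indeterminate, $t=s^2$. $V$ is the free $R$-module with basis $u,v_1,\dots,v_m$. The symplectic (alternating) bilinear form $(\cdot,\cdot)$ on $V$ is given by $(u,v_i)=(v_i,v_j)=1$ for all $i$ and all $j\neq i$, and $q$ is the quadratic form with associated bilinear form $(\cdot,\cdot)$ and $q(u)=1$, $q(v_1)=\dots=q(v_m)=t^{-1}$. $SO(V,q)=GO(V,q)$ is the group of $R$-module automorphisms of $V$ preserving $q$. $Cl=Cl(V,q)$ is the Clifford algebra, the quotient of the tensor algebra $T(V)$ by the ideal generated by the relations $w^2=q(w)$, $w\in V$; $V$ and $R$ are regarded as subsets of $Cl$. It is $\mathbb{Z}_2$-graded, $Cl=Cl^0\oplus Cl^1$. $x\mapsto\overline{x}$ is the anti-automorphism of $Cl$ reversing products of vectors (Clifford conjugation; in characteristic two it is just the transpose map $w_1\cdots w_k\mapsto w_k\cdots w_1$). The Clifford group is $C(V,q)=\{c\in Cl^\times : c^{-1}vc\in V \text{ for all } v\in V\}$, and $\pi:C(V,q)\to GO(V,q)=SO(V,q)$ sends $c$ to the map $v\mapsto c^{-1}vc$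 (maps acting on the right). $Pin(V,q)=\{c\in C(V,q): c\overline{c}=1\}$ and $Spin(V,q)=Pin(V,q)\cap Cl^0$. *)

theory Defs
  imports
    "HOL-Analysis.Finite_Cartesian_Product"
    "HOL-Algebra.Coset"
    "HOL-Library.Poly_Mapping"
    "HOL-Library.Z2"
begin

section \<open>The ring of Laurent polynomials over the field with two elements\<close>

text \<open>Laurent polynomials form the group algebra of the additive group of integers: the exponents are
  the keys, and multiplication is convolution.\<close>

type_synonym laurent = "int \<Rightarrow>\<^sub>0 bit"

definition lp_s :: laurent where
  "lp_s = Poly_Mapping.single 1 1"

definition lp_t :: laurent where
  "lp_t = lp_s\<^sup>2"

definition lp_t_inv :: laurent where
  "lp_t_inv = Poly_Mapping.single (-2) 1"

lemma lp_t_inverse: "lp_t * lp_t_inv = 1"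
  by (simp add: lp_t_def lp_s_def lp_t_inv_def power2_eq_square mult_single)

lemma lp_add_self [simp]: "x + x = (0 :: laurent)"
proof (rule poly_mapping_eqI)
  show "Poly_Mapping.lookup (x + x) k = Poly_Mapping.lookup 0 k" for k
    unfolding lookup_add by (cases "Poly_Mapping.lookup x k") simp_all
qed

section \<open>The quadratic module\<close>

text \<open>The index set of the basis of \<open>V\<close> is \<^typ>\<open>'n option\<close>, where \<open>None\<close> is the index of \<open>u\<close>, and
  \<open>Some i\<close> that of \<open>v\<^sub>i\<close>; the number \<open>m\<close> of the vectors \<open>v\<^sub>i\<close> is \<open>CARD('n)\<close>.\<close>

type_synonym 'n V = "laurent ^ 'n option"

definition vec_u :: "'n::finite V" where
  "vec_u = axis None 1"

definition vec_v :: "'n \<Rightarrow> 'n::finite V" where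
  "vec_v i = axis (Some i) 1"

definition bil :: "'n::finite V \<Rightarrow> 'n V \<Rightarrow> laurent" where
  "bil x y = (\<Sum>a\<in>UNIV. \<Sum>b\<in>UNIV - {a}. x $ a * y $ b)"

text \<open>The coordinate expression of \<open>q\<close>. The second sum runs over the unordered pairs of distinct basis
  vectors, each of which contributes with coefficient \<open>1\<close>, the value of the bilinear form on it.\<close>

definition q :: "'n::finite V \<Rightarrow> laurent" where
  "q x = (\<Sum>a\<in>UNIV. (case a of None \<Rightarrow> 1 | Some i \<Rightarrow> lp_t_inv) * (x $ a)\<^sup>2)
       + (\<Sum>A\<in>{A. card A = 2}. \<Prod>a\<in>A. x $ a)"

lemma bil_vec_u_vec_v: "bil vec_u (vec_v (i :: 'n::finite)) = 1"
proof -
  have "bil vec_u (vec_v i)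
      = (\<Sum>a\<in>UNIV. if a = (None :: 'n option) then (\<Sum>b\<in>UNIV - {None}. vec_v i $ b) else 0)"
    unfolding bil_def by (intro sum.cong refl) (auto simp: vec_u_def axis_def)
  also have "\<dots> = (\<Sum>b\<in>UNIV - {None}. if b = Some i then 1 else 0)"
    by (simp add: vec_v_def axis_def)
  also have "\<dots> = 1" by simp
  finally show ?thesis .
qed

lemma bil_vec_v_vec_v: "bil (vec_v i) (vec_v j) = (if i = j then 0 else 1)"
proof -
  have "bil (vec_v i) (vec_v j)
      = (\<Sum>a\<in>UNIV. if a = Some i then (\<Sum>b\<in>UNIV - {Some i}. vec_v j $ b) else 0)"
    unfolding bil_def by (intro sum.cong refl) (auto simp: vec_v_def axis_def)
  also have "\<dots> = (\<Sum>b\<in>UNIV - {Some i}. if b = Some j then 1 else 0)"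
    by (simp add: vec_v_def axis_def)
  also have "\<dots> = (if i = j then 0 else 1)" by auto
  finally show ?thesis .
qed

lemma bil_add_left: "bil (x + y) z = bil x z + bil y z"
  by (simp add: bil_def distrib_right sum.distrib)

lemma bil_add_right: "bil z (x + y) = bil z x + bil z y"
  by (simp add: bil_def distrib_left sum.distrib)

lemma bil_scale_left: "bil (c *s x) z = c * bil x z"
  by (simp add: bil_def sum_distrib_left mult.assoc)

lemma bil_scale_right: "bil z (c *s x) = c * bil z x"
  by (simp add: bil_def sum_distrib_left mult.left_commute)

lemma sum_unordered_pairs:
  fixes h :: "'a::finite \<Rightarrow> 'a \<Rightarrow> 'b::comm_monoid_add"
  assumes G: "\<And>a b. a \<noteq> b \<Longrightarrow> G {a, b} = h a b + h b a"
  shows "(\<Sum>A\<in>{A. card A = 2}. G A) = (\<Sum>a\<in>UNIV. \<Sum>b\<in>UNIV - {a}. h a b)"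
proof -
  let ?S = "Sigma UNIV (\<lambda>a. UNIV - {a}) :: ('a \<times> 'a) set"
  let ?g = "\<lambda>(a, b). {a, b} :: 'a set"
  have "(\<Sum>a\<in>UNIV. \<Sum>b\<in>UNIV - {a}. h a b) = (\<Sum>p\<in>?S. case_prod h p)"
    by (simp add: sum.Sigma)
  also have "\<dots> = (\<Sum>A\<in>{A. card A = 2}. \<Sum>p\<in>{p\<in>?S. ?g p = A}. case_prod h p)"
    by (rule sum.group [symmetric]) (auto simp: card_2_iff)
  also have "\<dots> = (\<Sum>A\<in>{A. card A = 2}. G A)"
  proof (rule sum.cong)
    fix A :: "'a set" assume "A \<in> {A. card A = 2}"
    then obtain a b where A: "A = {a, b}" and ab: "a \<noteq> b" by (auto simp: card_2_iff)
    have "{p\<in>?S. ?g p = A} = {(a, b), (b, a)}"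
      using ab by (auto simp: A doubleton_eq_iff)
    then show "(\<Sum>p\<in>{p\<in>?S. ?g p = A}. case_prod h p) = G A"
      using ab by (simp add: A G)
  qed simp
  finally show ?thesis ..
qed

lemma bil_self: "bil x x = 0"
proof -
  have "bil x x = (\<Sum>A\<in>{A :: 'a option set. card A = 2}. 0)"
    unfolding bil_def by (rule sum_unordered_pairs [symmetric]) (simp add: mult.commute)
  then show ?thesis by simp
qed

lemma q_scale: "q (c *s x) = c\<^sup>2 * q x"
proof -
  have "(\<Prod>a\<in>A. (c *s x) $ a) = c\<^sup>2 * (\<Prod>a\<in>A. x $ a)" if "card A = 2" for A
    using that by (simp add: prod.distrib)
  then show ?thesis
    by (simp add: q_def distrib_left sum_distrib_left power_mult_distrib mult.left_commute)
qed

lemma q_add: "q (x + y) = q x + q y + bil x y"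
proof -
  let ?P = "\<lambda>x A. \<Prod>a\<in>A. x $ a :: laurent"
  let ?S = "\<lambda>x. \<Sum>A\<in>{A. card A = 2}. ?P x A"
  have sq: "(z + w)\<^sup>2 = z\<^sup>2 + w\<^sup>2" for z w :: laurent
  proof -
    have "(z + w)\<^sup>2 = z\<^sup>2 + w\<^sup>2 + (z * w + z * w)"
      by (simp only: power2_eq_square algebra_simps)
    then show ?thesis by simp
  qed
  have "(\<Sum>A\<in>{A. card A = 2}. ?P (x + y) A + ?P x A + ?P y A) = bil x y"
    unfolding bil_def
  proof (rule sum_unordered_pairs)
    fix a b :: "'a option" assume ab: "a \<noteq> b"
    have "(z + z') * (w + w') + z * w + z' * w' = z * w' + w * z'" for z z' w w' :: laurent
    proof -
      have "(z + z') * (w + w') + z * w + z' * w'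
          = z * w' + w * z' + ((z * w + z * w) + (z' * w' + z' * w'))"
        by (simp only: algebra_simps)
      then show ?thesis by (simp only: lp_add_self add_0_right)
    qed
    then show "?P (x + y) {a, b} + ?P x {a, b} + ?P y {a, b} = x $ a * y $ b + x $ b * y $ a"
      using ab by (simp only: prod.insert prod.empty finite.intros insert_iff empty_iff
          vector_add_component mult_1_right simp_thms)
  qed
  then have S: "?S (x + y) + ?S x + ?S y = bil x y"
    by (simp only: sum.distrib)
  have "?S (x + y) + (?S x + ?S x) + (?S y + ?S y) = ?S x + ?S y + (?S (x + y) + ?S x + ?S y)"
    by (simp only: add_ac)
  then have "?S (x + y) = ?S x + ?S y + bil x y"
    by (simp only: S lp_add_self add_0_right)
  then show ?thesis
    by (simp add: q_def sq distrib_left sum.distrib add_ac)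
qed

lemma q_axis: "q (axis a 1) = (case a of None \<Rightarrow> 1 | Some i \<Rightarrow> lp_t_inv)"
proof -
  have prod: "(\<Prod>b\<in>A. axis a (1::laurent) $ b) = 0" if A: "card A = 2" for A :: "'a option set"
  proof -
    obtain b where "b \<in> A" "b \<noteq> a"
      using A by (auto simp: card_2_iff)
    then show ?thesis by (auto simp: axis_def intro!: prod_zero)
  qed
  have sum: "(\<Sum>b\<in>UNIV. (case b of None \<Rightarrow> 1 | Some i \<Rightarrow> lp_t_inv) * (axis a (1::laurent) $ b)\<^sup>2)
    = (\<Sum>b\<in>UNIV. if b = a then (case a of None \<Rightarrow> 1 | Some i \<Rightarrow> lp_t_inv) else 0)"
    by (rule sum.cong) (auto simp: axis_def)
  have "(\<Sum>A\<in>{A. card A = 2}. \<Prod>b\<in>A. axis a (1::laurent) $ b) = 0"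
    by (rule sum.neutral) (use prod in blast)
  then show ?thesis by (simp add: q_def sum)
qed

lemma q_vec_u: "q vec_u = 1"
  by (simp add: vec_u_def q_axis)

lemma q_vec_v: "q (vec_v i) = lp_t_inv"
  by (simp add: vec_v_def q_axis)

section \<open>The tensor algebra\<close>

datatype 'b letters = Letters (unletters: "'b list")

instantiation letters :: (type) monoid_add
begin

definition "0 = Letters []"

definition "x + y = Letters (unletters x @ unletters y)"

instance
  by standard (auto simp: zero_letters_def plus_letters_def)

end

text \<open>The tensor algebra of the free module \<open>V\<close> is the free associative algebra on the basis of \<open>V\<close>, that
  is, the monoid algebra of the free monoid on the basis indices: the word \<open>a\<^sub>1 \<dots> a\<^sub>k\<close> stands for the
  tensor product of the basis vectors with these indices.\<close>

type_synonym 'n tensor = "'n option letters \<Rightarrow>\<^sub>0 laurent"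

definition tensor_scalar :: "laurent \<Rightarrow> 'n tensor" where
  "tensor_scalar c = Poly_Mapping.single 0 c"

definition tensor_vec :: "'n::finite V \<Rightarrow> 'n tensor" where
  "tensor_vec x = (\<Sum>a\<in>UNIV. Poly_Mapping.single (Letters [a]) (x $ a))"

definition rev_letters :: "'b letters \<Rightarrow> 'b letters" where
  "rev_letters x = Letters (rev (unletters x))"

definition tensor_rev :: "'n tensor \<Rightarrow> 'n tensor" where
  "tensor_rev p = Poly_Mapping.map_key rev_letters p"

definition tensor_even :: "'n tensor set" where
  "tensor_even = {p. \<forall>x\<in>Poly_Mapping.keys p. even (length (unletters x))}"

lemma rev_letters_rev_letters [simp]: "rev_letters (rev_letters x) = x"
  by (simp add: rev_letters_def)

lemma rev_letters_zero: "rev_letters 0 = 0"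
  by (simp add: rev_letters_def zero_letters_def)

lemma rev_letters_plus: "rev_letters (x + y) = rev_letters y + rev_letters x"
  by (simp add: rev_letters_def plus_letters_def)

lemma inj_rev_letters: "inj rev_letters"
  by (metis injI rev_letters_rev_letters)

lemma lookup_tensor_rev: "Poly_Mapping.lookup (tensor_rev p) x = Poly_Mapping.lookup p (rev_letters x)"
  by (simp add: tensor_rev_def map_key.rep_eq inj_rev_letters)

lemma tensor_rev_single:
  "tensor_rev (Poly_Mapping.single x c) = Poly_Mapping.single (rev_letters x) c"
  by (rule poly_mapping_eqI) (auto simp: lookup_tensor_rev lookup_single when_def)

lemma tensor_rev_zero [simp]: "tensor_rev 0 = 0"
  by (rule poly_mapping_eqI) (simp add: lookup_tensor_rev)

lemma tensor_rev_add: "tensor_rev (p + p') = tensor_rev p + tensor_rev p'"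
  by (rule poly_mapping_eqI) (simp add: lookup_tensor_rev lookup_add)

lemma tensor_rev_diff: "tensor_rev (p - p') = tensor_rev p - tensor_rev p'"
  by (rule poly_mapping_eqI) (simp add: lookup_tensor_rev lookup_minus)

lemma tensor_rev_sum: "tensor_rev (sum f A) = (\<Sum>a\<in>A. tensor_rev (f a))"
  by (induction A rule: infinite_finite_induct) (simp_all add: tensor_rev_add)

lemma tensor_rev_scalar: "tensor_rev (tensor_scalar c) = tensor_scalar c"
  by (simp add: tensor_scalar_def tensor_rev_single rev_letters_zero)

lemma tensor_rev_vec: "tensor_rev (tensor_vec x) = tensor_vec x"
  by (simp add: tensor_vec_def tensor_rev_sum tensor_rev_single rev_letters_def)

lemma poly_mapping_eq_sum_single:
  fixes p :: "'a \<Rightarrow>\<^sub>0 'b::comm_monoid_add"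
  shows "p = (\<Sum>x\<in>Poly_Mapping.keys p. Poly_Mapping.single x (Poly_Mapping.lookup p x))"
  by (rule poly_mapping_eqI)
    (auto simp: lookup_sum lookup_single when_def sum.delta in_keys_iff)

lemma tensor_rev_mult: "tensor_rev (p * p') = tensor_rev p' * tensor_rev p"
proof -
  let ?s = "\<lambda>p x. Poly_Mapping.single x (Poly_Mapping.lookup p x) :: 'a tensor"
  have single: "tensor_rev (?s p x * ?s p' y) = tensor_rev (?s p' y) * tensor_rev (?s p x)" for x y
    by (simp add: mult_single tensor_rev_single rev_letters_plus mult.commute)
  have "tensor_rev ((\<Sum>x\<in>Poly_Mapping.keys p. ?s p x) * (\<Sum>y\<in>Poly_Mapping.keys p'. ?s p' y))
      = (\<Sum>x\<in>Poly_Mapping.keys p. \<Sum>y\<in>Poly_Mapping.keys p'. tensor_rev (?s p' y) * tensor_rev (?s p x))"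
    by (simp only: sum_product tensor_rev_sum single)
  also have "\<dots> = (\<Sum>y\<in>Poly_Mapping.keys p'. tensor_rev (?s p' y)) * (\<Sum>x\<in>Poly_Mapping.keys p. tensor_rev (?s p x))"
    by (simp only: sum_product) (rule sum.swap)
  also have "\<dots> = tensor_rev (\<Sum>y\<in>Poly_Mapping.keys p'. ?s p' y) * tensor_rev (\<Sum>x\<in>Poly_Mapping.keys p. ?s p x)"
    by (simp only: tensor_rev_sum)
  finally show ?thesis
    by (simp only: poly_mapping_eq_sum_single [symmetric])
qed

section \<open>The Clifford algebra\<close>

inductive_set two_sided_ideal :: "'a::ring_1 set \<Rightarrow> 'a set" for S :: "'a set" where
  zero: "0 \<in> two_sided_ideal S"
| gen: "x \<in> S \<Longrightarrow> x \<in> two_sided_ideal S"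
| add: "x \<in> two_sided_ideal S \<Longrightarrow> y \<in> two_sided_ideal S \<Longrightarrow> x + y \<in> two_sided_ideal S"
| mult_left: "x \<in> two_sided_ideal S \<Longrightarrow> a * x \<in> two_sided_ideal S"
| mult_right: "x \<in> two_sided_ideal S \<Longrightarrow> x * a \<in> two_sided_ideal S"

lemma two_sided_ideal_uminus: "x \<in> two_sided_ideal S \<Longrightarrow> - x \<in> two_sided_ideal S"
  using two_sided_ideal.mult_left [of x S "-1"] by simp

lemma two_sided_ideal_diff:
  "x \<in> two_sided_ideal S \<Longrightarrow> y \<in> two_sided_ideal S \<Longrightarrow> x - y \<in> two_sided_ideal S"
  using two_sided_ideal.add [of x S "- y"] by (simp add: two_sided_ideal_uminus)

definition clifford_ideal :: "'n::finite tensor set" where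
  "clifford_ideal =
     two_sided_ideal (range (\<lambda>w. tensor_vec w * tensor_vec w - tensor_scalar (q w)))"

definition clifford_rel :: "'n::finite tensor \<Rightarrow> 'n tensor \<Rightarrow> bool" where
  "clifford_rel x y \<longleftrightarrow> x - y \<in> clifford_ideal"

lemma equivp_clifford_rel: "equivp (clifford_rel :: 'n::finite tensor \<Rightarrow> 'n tensor \<Rightarrow> bool)" (is "equivp ?R")
proof (rule equivpI)
  show "reflp ?R"
    by (simp add: reflp_def clifford_rel_def clifford_ideal_def two_sided_ideal.zero)
  show "symp ?R"
  proof (rule sympI)
    fix x y :: "'n tensor"
    assume "clifford_rel x y"
    moreover have "y - x = - (x - y)" by simp
    ultimately show "clifford_rel y x"
      by (simp only: clifford_rel_def clifford_ideal_def two_sided_ideal_uminus)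
  qed
  show "transp ?R"
  proof (rule transpI)
    fix x y z :: "'n tensor"
    assume "clifford_rel x y" "clifford_rel y z"
    moreover have "x - z = (x - y) + (y - z)" by simp
    ultimately show "clifford_rel x z"
      by (simp only: clifford_rel_def clifford_ideal_def two_sided_ideal.add)
  qed
qed

quotient_type (overloaded) 'n cl = "'n::finite tensor" / clifford_rel
  by (rule equivp_clifford_rel)

instantiation cl :: (finite) "{ring, monoid_mult}"
begin

lift_definition zero_cl :: "'a cl" is 0 .

lift_definition one_cl :: "'a cl" is 1 .

lift_definition plus_cl :: "'a cl \<Rightarrow> 'a cl \<Rightarrow> 'a cl" is "(+)"
proof -
  fix x x' y y' :: "'a tensor"
  assume "clifford_rel x x'" "clifford_rel y y'"
  moreover have "(x + y) - (x' + y') = (x - x') + (y - y')" by simp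
  ultimately show "clifford_rel (x + y) (x' + y')"
    by (simp only: clifford_rel_def clifford_ideal_def two_sided_ideal.add)
qed

lift_definition minus_cl :: "'a cl \<Rightarrow> 'a cl \<Rightarrow> 'a cl" is "(-)"
proof -
  fix x x' y y' :: "'a tensor"
  assume "clifford_rel x x'" "clifford_rel y y'"
  moreover have "(x - y) - (x' - y') = (x - x') - (y - y')" by simp
  ultimately show "clifford_rel (x - y) (x' - y')"
    by (simp only: clifford_rel_def clifford_ideal_def two_sided_ideal_diff)
qed

lift_definition uminus_cl :: "'a cl \<Rightarrow> 'a cl" is uminus
proof -
  fix x x' :: "'a tensor"
  assume "clifford_rel x x'"
  moreover have "(- x) - (- x') = - (x - x')" by simp
  ultimately show "clifford_rel (- x) (- x')"
    by (simp only: clifford_rel_def clifford_ideal_def two_sided_ideal_uminus)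
qed

lift_definition times_cl :: "'a cl \<Rightarrow> 'a cl \<Rightarrow> 'a cl" is "(*)"
proof -
  fix x x' y y' :: "'a tensor"
  assume "clifford_rel x x'" "clifford_rel y y'"
  moreover have "x * y - x' * y' = x * (y - y') + (x - x') * y'" by (simp add: algebra_simps)
  ultimately show "clifford_rel (x * y) (x' * y')"
    by (simp only: clifford_rel_def clifford_ideal_def
        two_sided_ideal.add two_sided_ideal.mult_left two_sided_ideal.mult_right)
qed

instance
proof
  fix a b c :: "'a cl"
  note refl = equivp_reflp [OF equivp_clifford_rel]
  show "a + b + c = a + (b + c)" by transfer (simp add: add.assoc refl)
  show "a + b = b + a" by transfer (simp add: add.commute refl)
  show "0 + a = a" by transfer (simp add: refl)
  show "- a + a = 0" by transfer (simp add: refl)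
  show "a - b = a + - b" by transfer (simp add: refl)
  show "a * b * c = a * (b * c)" by transfer (simp add: mult.assoc refl)
  show "1 * a = a" by transfer (simp add: refl)
  show "a * 1 = a" by transfer (simp add: refl)
  show "(a + b) * c = a * c + b * c" by transfer (simp add: distrib_right refl)
  show "a * (b + c) = a * b + a * c" by transfer (simp add: distrib_left refl)
qed

end

lift_definition cl_scalar :: "laurent \<Rightarrow> 'n::finite cl" is tensor_scalar .

lift_definition cl_vec :: "'n::finite V \<Rightarrow> 'n cl" is tensor_vec .

lemma cl_vec_square: "cl_vec w * cl_vec w = cl_scalar (q w)"
  by transfer (auto simp: clifford_rel_def clifford_ideal_def intro: two_sided_ideal.gen)

text \<open>The anti-automorphism that reverses products of vectors is induced by the reversal of words in the
  tensor algebra; the lemmas below characterise it.\<close>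

lift_definition cl_conj :: "'n::finite cl \<Rightarrow> 'n cl" is tensor_rev
proof -
  have ideal: "tensor_rev p \<in> clifford_ideal" if "p \<in> clifford_ideal" for p :: "'n tensor"
    using that unfolding clifford_ideal_def
  proof induction
    case (gen p)
    then show ?case
      by (auto simp: tensor_rev_diff tensor_rev_mult tensor_rev_vec tensor_rev_scalar
          intro: two_sided_ideal.gen)
  qed (auto simp: tensor_rev_add tensor_rev_mult intro: two_sided_ideal.intros)
  fix x y :: "'n tensor" assume "clifford_rel x y"
  then show "clifford_rel (tensor_rev x) (tensor_rev y)"
    using ideal by (simp add: clifford_rel_def tensor_rev_diff [symmetric])
qed

lemma cl_conj_vec: "cl_conj (cl_vec w) = cl_vec w"
  by transfer (simp add: tensor_rev_vec equivp_reflp [OF equivp_clifford_rel])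

lemma cl_conj_scalar: "cl_conj (cl_scalar c) = cl_scalar c"
  by transfer (simp add: tensor_rev_scalar equivp_reflp [OF equivp_clifford_rel])

lemma cl_conj_add: "cl_conj (x + y) = cl_conj x + cl_conj y"
  by transfer (simp add: tensor_rev_add equivp_reflp [OF equivp_clifford_rel])

lemma cl_conj_mult: "cl_conj (x * y) = cl_conj y * cl_conj x"
  by transfer (simp add: tensor_rev_mult equivp_reflp [OF equivp_clifford_rel])

definition cl_even :: "'n::finite cl set" where
  "cl_even = abs_cl ` tensor_even"

section \<open>The Clifford group and its action on the module\<close>

definition cl_monoid :: "'n::finite cl monoid" where
  "cl_monoid = \<lparr>carrier = UNIV, mult = (*), one = 1\<rparr>"

definition clifford_group :: "'n::finite cl monoid" where
  "clifford_group = cl_monoid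
     \<lparr>carrier := {c \<in> Units cl_monoid.
        \<forall>v. inv\<^bsub>cl_monoid\<^esub> c * cl_vec v * c \<in> range cl_vec}\<rparr>"

text \<open>Maps act on the right, so that the product of \<open>f\<close> and \<open>g\<close> applies \<open>f\<close> first.\<close>

definition GO :: "('n::finite V \<Rightarrow> 'n V) monoid" where
  "GO = \<lparr>carrier = {f. module_hom (*s) (*s) f \<and> bij f \<and> (\<forall>x. q (f x) = q x)},
         mult = (\<lambda>f g. g \<circ> f), one = id\<rparr>"

text \<open>Since \<^const>\<open>cl_vec\<close> is injective, \<open>V\<close> can be regarded as a subset of the Clifford algebra; \<open>cl_pi c v\<close> is
  the vector that corresponds to \<open>c\<^sup>-\<^sup>1 v c\<close>.\<close>

definition cl_pi :: "'n::finite cl \<Rightarrow> 'n V \<Rightarrow> 'n V" where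
  "cl_pi c = (\<lambda>v. the_inv cl_vec (inv\<^bsub>cl_monoid\<^esub> c * cl_vec v * c))"

definition Pin :: "'n::finite cl set" where
  "Pin = {c \<in> carrier clifford_group. c * cl_conj c = 1}"

definition Spin :: "'n::finite cl set" where
  "Spin = Pin \<inter> cl_even"

end

theory Submission
  imports Defs
begin

text \<open>An element of \<open>Pin\<close> acts trivially on \<open>V\<close> exactly if it commutes with every vector, that is, if it
  is central in the Clifford algebra, because \<open>V\<close> generates that algebra. So everything rests on the
  centre, which for even \<open>m\<close> is \<open>R \<oplus> R r\<close>: the vector \<open>r\<close> spans the radical of the bilinear form. For
  \<open>c = \<alpha> + \<beta> r\<close> the reversal fixes \<open>c\<close>, so the condition for \<open>Pin\<close> reads
  \<open>1 = c\<^sup>2 = \<alpha>\<^sup>2 + \<beta>\<^sup>2 q(r)\<close>, and \<open>q(r) = 1 + m t\<^sup>-\<^sup>1 + (m + 1) m / 2\<close> is \<open>0\<close> if \<open>m \<equiv> 2\<close> and \<open>1\<close> if \<open>m \<equiv> 0\<close>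
  modulo \<open>4\<close>. As squaring is injective on the domain \<open>R\<close> of characteristic two, this means \<open>\<alpha> = 1\<close>
  in the first case and \<open>\<alpha> + \<beta> = 1\<close> in the second, which gives the two families
  (lemma \<open>kernel_Pin\<close>). The odd summand \<open>\<beta> r\<close> of an even central element vanishes, so that a central
  element of \<open>Spin\<close> is \<open>1\<close>.

  To determine the centre one has to know when an element of the Clifford algebra, which is given by
  generators and relations, vanishes. The exterior algebra on the basis of \<open>V\<close> serves as a
  model: in characteristic two it has no signs, so its elements are just families of scalars
  indexed by the sets of basis indices. Splitting the bilinear form as the symmetrisation of a
  triangular form \<open>B\<close> with \<open>B(x,x) = q(x)\<close>, Chevalley's construction lets a basis vector \<open>e\<^sub>a\<close> act on
  the model by \<open>e\<^sub>a \<and> -\<close> plus the contraction with \<open>B(e\<^sub>a,-)\<close>. Applying an element to the unit of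
  the exterior algebra gives its symbol, and the symbol determines the element because the
  ordered products of basis vectors obey the same multiplication rule (lemmas \<open>cl_gen_ordered_prod\<close>
  and \<open>quantize_symbol\<close>). Right multiplication by \<open>e\<^sub>a\<close> corresponds to \<open>e\<^sub>a \<and> -\<close> plus the contraction
  with \<open>B(-,e\<^sub>a)\<close>. Hence the commutator with \<open>e\<^sub>a\<close> becomes the contraction with the linear form
  \<open>(e\<^sub>a,-)\<close>, and the centre is found by solving linear equations
  (lemma \<open>central_imp_scalar_plus_radical\<close>).\<close>

section \<open>Arithmetic in characteristic two\<close>

lemma laurent_add_eq_0_iff: "a + b = 0 \<longleftrightarrow> a = (b :: laurent)"
  by (metis add.assoc add.right_neutral lp_add_self add.commute)

lemma laurent_square_eq_1_iff: "a * a = 1 \<longleftrightarrow> a = (1 :: laurent)"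
proof
  assume "a * a = 1"
  moreover have "(a + 1) * (a + 1) = a * a + 1 + (a + a)"
    by (simp only: distrib_left distrib_right mult_1 mult_1_right add_ac)
  ultimately have "(a + 1) * (a + 1) = 0"
    by simp
  then show "a = 1"
    by (simp add: laurent_add_eq_0_iff)
qed simp

lemma laurent_of_nat: "of_nat n = (if even n then 0 else 1 :: laurent)"
  by (induction n) auto

lemma laurent_vec_add_self [simp]: "f + f = (0 :: laurent ^ 'b)"
  by (simp only: vec_eq_iff vector_add_component lp_add_self zero_index simp_thms)

lemma sum_symmetric_char2:
  fixes g :: "'a::finite \<Rightarrow> 'a \<Rightarrow> 'b::comm_monoid_add"
  assumes sym: "\<And>a b. g a b = g b a" and char2: "\<And>x :: 'b. x + x = 0"
  shows "(\<Sum>a\<in>UNIV. \<Sum>b\<in>UNIV. g a b) = (\<Sum>a\<in>UNIV. g a a)"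
proof -
  have "(\<Sum>a\<in>UNIV. \<Sum>b\<in>UNIV - {a}. g a b) = (\<Sum>A\<in>{A :: 'a set. card A = 2}. 0)"
    by (rule sum_unordered_pairs [symmetric]) (simp only: sym [of b a for a b] char2)
  moreover have "(\<Sum>a\<in>UNIV. \<Sum>b\<in>UNIV. g a b)
      = (\<Sum>a\<in>UNIV. g a a + (\<Sum>b\<in>UNIV - {a}. g a b))"
    by (intro sum.cong refl sum.remove) auto
  ultimately show ?thesis
    by (simp add: sum.distrib)
qed

section \<open>Operators on the exterior algebra\<close>

text \<open>The coefficient at a set \<open>A\<close> belongs to the wedge product of the basis vectors with indices in \<open>A\<close>.
  In characteristic two this product does not depend on an order of \<open>A\<close>.\<close>

type_synonym 'b ext = "laurent ^ 'b set"

definition wedge :: "'b::finite \<Rightarrow> 'b ext \<Rightarrow> 'b ext" where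
  "wedge a f = (\<chi> A. if a \<in> A then f $ (A - {a}) else 0)"

definition contract1 :: "'b::finite \<Rightarrow> 'b ext \<Rightarrow> 'b ext" where
  "contract1 b f = (\<chi> A. if b \<in> A then 0 else f $ insert b A)"

definition contract :: "('b::finite \<Rightarrow> laurent) \<Rightarrow> 'b ext \<Rightarrow> 'b ext" where
  "contract \<beta> f = (\<Sum>b\<in>UNIV. \<beta> b *s contract1 b f)"

text \<open>The common shape of left and right multiplication by a basis vector.\<close>

definition mult_op :: "'b::finite \<Rightarrow> ('b \<Rightarrow> laurent) \<Rightarrow> 'b ext \<Rightarrow> 'b ext" where
  "mult_op a \<beta> f = wedge a f + contract \<beta> f"

lemma wedge_add: "wedge a (f + g) = wedge a f + wedge a g"
  by (simp add: wedge_def vec_eq_iff)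

lemma wedge_scale: "wedge a (c *s f) = c *s wedge a f"
  by (simp add: wedge_def vec_eq_iff)

lemma wedge_0: "wedge a 0 = 0"
  by (simp add: wedge_def vec_eq_iff)

lemma wedge_sum: "wedge a (sum f S) = (\<Sum>x\<in>S. wedge a (f x))"
  by (induction S rule: infinite_finite_induct) (simp_all add: wedge_add wedge_0)

lemma contract1_add: "contract1 a (f + g) = contract1 a f + contract1 a g"
  by (simp add: contract1_def vec_eq_iff)

lemma contract1_scale: "contract1 a (c *s f) = c *s contract1 a f"
  by (simp add: contract1_def vec_eq_iff)

lemma contract1_0: "contract1 a 0 = 0"
  by (simp add: contract1_def vec_eq_iff)

lemma contract1_sum: "contract1 a (sum f S) = (\<Sum>x\<in>S. contract1 a (f x))"
  by (induction S rule: infinite_finite_induct) (simp_all add: contract1_add contract1_0)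

lemma scale_sum: "c *s sum f S = (\<Sum>x\<in>S. c *s (f x :: laurent ^ 'b))"
  by (induction S rule: infinite_finite_induct) (simp_all add: vector_add_ldistrib)

lemma sum_scale: "sum c S *s f = (\<Sum>x\<in>S. c x *s (f :: laurent ^ 'b))"
  by (induction S rule: infinite_finite_induct) (simp_all add: vector_sadd_rdistrib)

lemma contract_add: "contract \<beta> (f + g) = contract \<beta> f + contract \<beta> g"
  by (simp add: contract_def contract1_add vector_add_ldistrib sum.distrib)

lemma contract_scale: "contract \<beta> (c *s f) = c *s contract \<beta> f"
  by (simp add: contract_def contract1_scale scale_sum vector_smult_assoc mult.commute)

lemma contract_plus: "contract (\<lambda>b. \<beta> b + \<gamma> b) f = contract \<beta> f + contract \<gamma> f"
  by (simp add: contract_def vector_sadd_rdistrib sum.distrib)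

lemma mult_op_add: "mult_op a \<beta> (f + g) = mult_op a \<beta> f + mult_op a \<beta> g"
  by (simp add: mult_op_def wedge_add contract_add)

lemma mult_op_scale: "mult_op a \<beta> (c *s f) = c *s mult_op a \<beta> f"
  by (simp add: mult_op_def wedge_scale contract_scale vector_add_ldistrib)

lemma mult_op_0: "mult_op a \<beta> 0 = 0"
  using mult_op_scale [of a \<beta> 0 0] by simp

lemma mult_op_sum: "mult_op a \<beta> (sum f S) = (\<Sum>x\<in>S. mult_op a \<beta> (f x))"
  by (induction S rule: infinite_finite_induct) (simp_all add: mult_op_add mult_op_0)

lemma wedge_commute: "wedge a (wedge b f) = wedge b (wedge a f)"
  by (auto simp: wedge_def vec_eq_iff Diff_insert [symmetric] insert_commute)

lemma wedge_wedge_self: "wedge a (wedge a f) = 0"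
  by (simp add: wedge_def vec_eq_iff)

lemma contract1_commute: "contract1 a (contract1 b f) = contract1 b (contract1 a f)"
  by (auto simp: contract1_def vec_eq_iff insert_commute)

lemma contract1_contract1_self: "contract1 a (contract1 a f) = 0"
  by (simp add: contract1_def vec_eq_iff)

text \<open>Contraction is a derivation of the exterior algebra, without the usual sign in characteristic two,
  so the commutator with the wedge product by a basis vector is a scalar.\<close>

lemma wedge_contract1:
  "wedge a (contract1 b f) + contract1 b (wedge a f) = (if a = b then f else 0)"
proof (cases "a = b")
  case True
  then show ?thesis
    by (auto simp: wedge_def contract1_def vec_eq_iff insert_absorb)
next
  case False
  then show ?thesis
    by (auto simp: wedge_def contract1_def vec_eq_iff insert_Diff_if)
qed

lemma wedge_contract: "wedge a (contract \<beta> f) + contract \<beta> (wedge a f) = \<beta> a *s f"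
proof -
  have "wedge a (contract \<beta> f) + contract \<beta> (wedge a f)
      = (\<Sum>b\<in>UNIV. \<beta> b *s (wedge a (contract1 b f) + contract1 b (wedge a f)))"
    by (simp add: contract_def wedge_sum wedge_scale sum.distrib vector_add_ldistrib)
  also have "\<dots> = (\<Sum>b\<in>UNIV. if b = a then \<beta> b *s f else 0)"
    by (intro sum.cong) (auto simp: wedge_contract1)
  finally show ?thesis by simp
qed

lemma contract_contract:
  "contract \<beta> (contract \<gamma> f) = (\<Sum>b\<in>UNIV. \<Sum>c\<in>UNIV. (\<beta> b * \<gamma> c) *s contract1 b (contract1 c f))"
  by (simp add: contract_def contract1_sum contract1_scale scale_sum vector_smult_assoc)

lemma contract_commute: "contract \<beta> (contract \<gamma> f) = contract \<gamma> (contract \<beta> f)"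
  unfolding contract_contract
  by (subst sum.swap) (simp add: contract1_commute mult.commute)

lemma contract_contract_self: "contract \<beta> (contract \<beta> f) = 0"
proof -
  have "contract \<beta> (contract \<beta> f) = (\<Sum>b\<in>UNIV. (\<beta> b * \<beta> b) *s contract1 b (contract1 b f))"
    unfolding contract_contract
    by (rule sum_symmetric_char2) (simp_all add: contract1_commute mult.commute)
  then show ?thesis
    by (simp add: contract1_contract1_self)
qed

text \<open>Wedge products commute with each other, and so do contractions; only the two mixed terms remain.
  The lemma yields both the Clifford relations for left multiplications and the fact that left and
  right multiplications commute, where the two values of the half form coincide and cancel.\<close>

lemma mult_op_anticommute:
  "mult_op a \<beta> (mult_op b \<gamma> f) + mult_op b \<gamma> (mult_op a \<beta> f) = (\<beta> b + \<gamma> a) *s f"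
proof -
  have "mult_op a \<beta> (mult_op b \<gamma> f) + mult_op b \<gamma> (mult_op a \<beta> f)
      = (wedge a (wedge b f) + wedge b (wedge a f))
        + (contract \<beta> (contract \<gamma> f) + contract \<gamma> (contract \<beta> f))
        + (wedge a (contract \<gamma> f) + contract \<gamma> (wedge a f))
        + (wedge b (contract \<beta> f) + contract \<beta> (wedge b f))"
    by (simp only: mult_op_def wedge_add contract_add add_ac)
  also have "\<dots> = \<gamma> a *s f + \<beta> b *s f"
    by (simp only: wedge_contract wedge_commute [of a b] contract_commute [of \<beta> \<gamma>]
        laurent_vec_add_self add_0)
  finally show ?thesis
    by (simp only: vector_sadd_rdistrib add.commute)
qed

text \<open>This does not follow from the preceding lemma, which for equal operators only says \<open>0 = 0\<close>.\<close>

lemma mult_op_square: "mult_op a \<beta> (mult_op a \<beta> f) = \<beta> a *s f"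
proof -
  have "mult_op a \<beta> (mult_op a \<beta> f)
      = wedge a (wedge a f) + contract \<beta> (contract \<beta> f)
        + (wedge a (contract \<beta> f) + contract \<beta> (wedge a f))"
    by (simp only: mult_op_def wedge_add contract_add add_ac)
  then show ?thesis
    by (simp add: wedge_wedge_self contract_contract_self wedge_contract)
qed

lemma mult_op_axis_empty: "mult_op a \<beta> (axis {} 1) = axis {a} 1"
proof -
  have "contract1 b (axis {} 1) = 0" for b :: 'a
    by (simp add: contract1_def vec_eq_iff axis_def)
  then have "contract \<beta> (axis {} 1) = 0"
    by (simp add: contract_def)
  moreover have "wedge a (axis {} 1) = axis {a} 1"
    by (auto simp: wedge_def vec_eq_iff axis_def)
  ultimately show ?thesis
    by (simp add: mult_op_def)
qed


section \<open>The Clifford algebra acts on the exterior algebra\<close>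

text \<open>An arbitrary linear order on the basis indices.\<close>

definition rank :: "'b::finite \<Rightarrow> nat" where
  "rank = (SOME f. inj f)"

lemma inj_rank: "inj (rank :: 'b::finite \<Rightarrow> nat)"
proof -
  have "\<exists>f :: 'b \<Rightarrow> nat. inj f"
    using finite_imp_inj_to_nat_seg [of "UNIV :: 'b set"] by auto
  then show ?thesis
    unfolding rank_def by (rule someI_ex)
qed

lemma rank_eq_iff: "rank a = rank b \<longleftrightarrow> a = b"
  using inj_rank by (auto dest: injD)

text \<open>In characteristic two a quadratic form is not half of its bilinear form, but it is the
  diagonal of a bilinear form that is triangular for the chosen order. Its orientation
  matches \<open>ordered_prod\<close> below: moving \<open>e\<^sub>a\<close> to its place in an increasing product, one has to pass
  exactly the factors of smaller rank.\<close>

definition half_form :: "'n::finite option \<Rightarrow> 'n option \<Rightarrow> laurent" where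
  "half_form a b = (if a = b then q (axis a 1) else if rank b < rank a then 1 else 0)"

lemma half_form_self: "half_form a a = q (axis a 1)"
  by (simp add: half_form_def)

lemma half_form_add_flip: "a \<noteq> b \<Longrightarrow> half_form a b + half_form b a = 1"
  using rank_eq_iff [of a b] by (auto simp: half_form_def)

definition lmult :: "'n::finite option \<Rightarrow> 'n option ext \<Rightarrow> 'n option ext" where
  "lmult a = mult_op a (half_form a)"

definition rmult :: "'n::finite option \<Rightarrow> 'n option ext \<Rightarrow> 'n option ext" where
  "rmult a = mult_op a (\<lambda>b. half_form b a)"

lemma rmult_lmult: "rmult a (lmult b f) = lmult b (rmult a f)"
proof -
  have "rmult a (lmult b f) + lmult b (rmult a f) = 0"
    by (simp add: rmult_def lmult_def mult_op_anticommute)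
  then have "(rmult a (lmult b f) + lmult b (rmult a f)) + lmult b (rmult a f) = lmult b (rmult a f)"
    by simp
  then show ?thesis
    by (simp only: add.assoc laurent_vec_add_self add_0_right)
qed

definition word_act :: "'n::finite option letters \<Rightarrow> 'n option ext \<Rightarrow> 'n option ext" where
  "word_act w f = foldr lmult (unletters w) f"

definition tensor_act :: "'n::finite tensor \<Rightarrow> 'n option ext \<Rightarrow> 'n option ext" where
  "tensor_act p f = (\<Sum>w\<in>Poly_Mapping.keys p. Poly_Mapping.lookup p w *s word_act w f)"

lemma word_act_0: "word_act 0 f = f"
  by (simp add: word_act_def zero_letters_def)

lemma word_act_plus: "word_act (v + w) f = word_act v (word_act w f)"
  by (simp add: word_act_def plus_letters_def)

lemma word_act_add: "word_act w (f + g) = word_act w f + word_act w g"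
proof -
  have "foldr lmult ws (f + g) = foldr lmult ws f + foldr lmult ws g" for ws
    by (induction ws) (simp_all add: lmult_def mult_op_add)
  then show ?thesis by (simp add: word_act_def)
qed

lemma word_act_scale: "word_act w (c *s f) = c *s word_act w f"
proof -
  have "foldr lmult ws (c *s f) = c *s foldr lmult ws f" for ws
    by (induction ws) (simp_all add: lmult_def mult_op_scale)
  then show ?thesis by (simp add: word_act_def)
qed

lemma tensor_act_superset:
  assumes "finite S" "Poly_Mapping.keys p \<subseteq> S"
  shows "tensor_act p f = (\<Sum>w\<in>S. Poly_Mapping.lookup p w *s word_act w f)"
  unfolding tensor_act_def using assms
  by (intro sum.mono_neutral_left) (auto simp: in_keys_iff)

lemma tensor_act_0: "tensor_act 0 f = 0"
  by (simp add: tensor_act_def)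

lemma tensor_act_single: "tensor_act (Poly_Mapping.single w c) f = c *s word_act w f"
  using tensor_act_superset [of "{w}" "Poly_Mapping.single w c" f] by simp

lemma tensor_act_plus: "tensor_act (p + p') f = tensor_act p f + tensor_act p' f"
proof -
  let ?S = "Poly_Mapping.keys p \<union> Poly_Mapping.keys p'"
  have "tensor_act (p + p') f = (\<Sum>w\<in>?S. Poly_Mapping.lookup (p + p') w *s word_act w f)"
    by (rule tensor_act_superset) (simp_all add: Poly_Mapping.keys_add)
  also have "\<dots> = tensor_act p f + tensor_act p' f"
    by (simp add: tensor_act_superset [of ?S] lookup_add vector_sadd_rdistrib sum.distrib)
  finally show ?thesis .
qed

lemma tensor_act_minus: "tensor_act (p - p') f = tensor_act p f - tensor_act p' f"
  using tensor_act_plus [of "p - p'" p' f] by (simp add: algebra_simps)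

lemma tensor_act_sum: "tensor_act (sum p S) f = (\<Sum>x\<in>S. tensor_act (p x) f)"
  by (induction S rule: infinite_finite_induct) (simp_all add: tensor_act_plus tensor_act_0)

lemma tensor_act_add: "tensor_act p (f + g) = tensor_act p f + tensor_act p g"
  by (simp add: tensor_act_def word_act_add vector_add_ldistrib sum.distrib)

lemma tensor_act_scale: "tensor_act p (c *s f) = c *s tensor_act p f"
  by (simp add: tensor_act_def word_act_scale scale_sum vector_smult_assoc mult.commute)

lemma tensor_induct [case_names zero single add]:
  assumes "P 0" "\<And>w c. P (Poly_Mapping.single w c)" "\<And>p p'. P p \<Longrightarrow> P p' \<Longrightarrow> P (p + p')"
  shows "P (p :: 'n tensor)"
proof -
  have "P (sum g S)" if "\<And>x. P (g x)" for g :: "_ \<Rightarrow> 'n tensor" and S :: "'n option letters set"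
    by (induction S rule: infinite_finite_induct) (simp_all add: assms that)
  then show ?thesis
    by (subst poly_mapping_eq_sum_single) (simp add: assms(2))
qed

lemma tensor_act_mult: "tensor_act (p * p') f = tensor_act p (tensor_act p' f)"
proof (induction p rule: tensor_induct)
  case (single w c)
  show ?case
    by (induction p' rule: tensor_induct)
      (simp_all add: tensor_act_0 tensor_act_plus tensor_act_add distrib_left mult_single
        tensor_act_single word_act_plus word_act_scale vector_smult_assoc vector_add_ldistrib
        word_act_add tensor_act_scale [of _ 0 0, simplified])
qed (simp_all add: tensor_act_0 tensor_act_plus distrib_right)

lemma tensor_act_scalar: "tensor_act (tensor_scalar c) f = c *s f"
  by (simp add: tensor_scalar_def tensor_act_single word_act_0)

lemma tensor_act_vec: "tensor_act (tensor_vec x) f = (\<Sum>a\<in>UNIV. x $ a *s lmult a f)"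
  by (simp add: tensor_vec_def tensor_act_sum tensor_act_single word_act_def)

text \<open>The diagonal terms of the double sum give the values of \<open>q\<close> on the basis, and each unordered pair of
  different indices gives the polar form on that pair, which is \<open>1\<close>; this is the coordinate
  expression of \<open>q\<close>.\<close>

lemma tensor_act_vec_square: "tensor_act (tensor_vec x) (tensor_act (tensor_vec x) f) = q x *s f"
proof -
  let ?h = "\<lambda>a b. (x $ a * x $ b) *s lmult a (lmult b f)"
  have pairs: "(\<Sum>A\<in>{A. card A = 2}. (\<Prod>a\<in>A. x $ a) *s f)
      = (\<Sum>a\<in>UNIV. \<Sum>b\<in>UNIV - {a}. ?h a b)"
  proof (rule sum_unordered_pairs)
    fix a b :: "'a option" assume ab: "a \<noteq> b"
    then have "lmult a (lmult b f) + lmult b (lmult a f) = f"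
      by (simp add: lmult_def mult_op_anticommute half_form_add_flip)
    then have "?h a b + ?h b a = (x $ a * x $ b) *s f"
      by (metis mult.commute vector_add_ldistrib)
    then show "(\<Prod>a\<in>{a, b}. x $ a) *s f = ?h a b + ?h b a"
      using ab by simp
  qed
  have "tensor_act (tensor_vec x) (tensor_act (tensor_vec x) f) = (\<Sum>a\<in>UNIV. \<Sum>b\<in>UNIV. ?h a b)"
    by (simp add: tensor_act_vec lmult_def mult_op_sum mult_op_scale scale_sum vector_smult_assoc)
  also have "\<dots> = (\<Sum>a\<in>UNIV. ?h a a + (\<Sum>b\<in>UNIV - {a}. ?h a b))"
    by (intro sum.cong refl sum.remove) auto
  also have "\<dots> = (\<Sum>a\<in>UNIV. (q (axis a 1) * (x $ a)\<^sup>2) *s f)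
      + (\<Sum>A\<in>{A. card A = 2}. (\<Prod>a\<in>A. x $ a) *s f)"
    by (simp add: sum.distrib pairs lmult_def mult_op_square half_form_self vector_smult_assoc
        power2_eq_square mult.commute)
  also have "\<dots> = q x *s f"
    by (simp add: q_def [of x] q_axis vector_sadd_rdistrib sum_scale)
  finally show ?thesis .
qed

lemma tensor_act_clifford_ideal: "p \<in> clifford_ideal \<Longrightarrow> tensor_act p f = 0"
  unfolding clifford_ideal_def
proof (induction arbitrary: f rule: two_sided_ideal.induct)
  case (gen x)
  then show ?case
    by (auto simp: tensor_act_minus tensor_act_mult tensor_act_vec_square tensor_act_scalar)
next
  case (mult_left x a)
  then show ?case
    using tensor_act_scale [of a 0 0] by (simp add: tensor_act_mult)
qed (simp_all add: tensor_act_0 tensor_act_plus tensor_act_mult)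

lift_definition cl_act :: "'n::finite cl \<Rightarrow> 'n option ext \<Rightarrow> 'n option ext" is tensor_act
proof -
  fix x y :: "'n tensor" assume "clifford_rel x y"
  then show "tensor_act x = tensor_act y"
    using tensor_act_clifford_ideal [of "x - y"]
    by (auto simp: clifford_rel_def tensor_act_minus)
qed

lemma cl_act_plus: "cl_act (c + d) f = cl_act c f + cl_act d f"
  by transfer (rule tensor_act_plus)

lemma cl_act_mult: "cl_act (c * d) f = cl_act c (cl_act d f)"
  by transfer (rule tensor_act_mult)

lemma cl_act_scalar: "cl_act (cl_scalar c) f = c *s f"
  by transfer (rule tensor_act_scalar)

lemma cl_act_vec: "cl_act (cl_vec x) f = (\<Sum>a\<in>UNIV. x $ a *s lmult a f)"
  by transfer (rule tensor_act_vec)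

section \<open>Ordered products span the Clifford algebra\<close>

lemma cl_rel_refl: "clifford_rel p p"
  by (rule equivp_reflp [OF equivp_clifford_rel])

lemma cl_scalar_0: "cl_scalar 0 = 0"
  by transfer (simp add: tensor_scalar_def cl_rel_refl)

lemma cl_scalar_1: "cl_scalar 1 = 1"
  by transfer (simp add: tensor_scalar_def cl_rel_refl)

lemma cl_scalar_add: "cl_scalar (a + b) = cl_scalar a + cl_scalar b"
  by transfer (simp add: tensor_scalar_def single_add cl_rel_refl)

lemma cl_scalar_mult: "cl_scalar (a * b) = cl_scalar a * cl_scalar b"
  by transfer (simp add: tensor_scalar_def mult_single cl_rel_refl)

lemma cl_scalar_commute: "cl_scalar a * c = c * cl_scalar a"
proof transfer
  fix a and p :: "'b::finite tensor"
  have "tensor_scalar a * p = p * tensor_scalar a"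
    by (induction p rule: tensor_induct)
      (simp_all add: tensor_scalar_def mult_single distrib_left distrib_right mult.commute)
  then show "clifford_rel (tensor_scalar a * p) (p * tensor_scalar a)"
    by (simp add: cl_rel_refl)
qed

lemma cl_add_self [simp]: "c + c = (0 :: 'n::finite cl)"
proof -
  have "c + c = cl_scalar (1 + 1) * c"
    by (simp only: cl_scalar_add cl_scalar_1 distrib_right mult_1)
  then show ?thesis
    by (simp only: lp_add_self cl_scalar_0 mult_zero_left)
qed

lemma cl_add_eq_0_iff: "c + d = 0 \<longleftrightarrow> c = (d :: 'n::finite cl)"
  by (metis add.assoc add.right_neutral cl_add_self add.commute)

lemma cl_vec_add: "cl_vec (x + y) = cl_vec x + cl_vec y"
  by transfer (simp add: tensor_vec_def single_add sum.distrib cl_rel_refl)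

lemma cl_vec_anticommute: "cl_vec x * cl_vec y + cl_vec y * cl_vec x = cl_scalar (bil x y)"
proof -
  have "cl_scalar (q (x + y)) = cl_scalar (q x) + cl_scalar (q y)
      + (cl_vec x * cl_vec y + cl_vec y * cl_vec x)"
    by (simp only: cl_vec_square [symmetric] cl_vec_add distrib_left distrib_right add_ac)
  then show ?thesis
    by (simp add: q_add cl_scalar_add)
qed

lemma bil_axis: "bil (axis a 1) (axis b 1) = (if a = b then 0 else 1)"
proof -
  have "bil (axis a 1) (axis b 1)
      = (\<Sum>c\<in>UNIV. if c = a then (\<Sum>d\<in>UNIV - {a}. axis b 1 $ d) else 0)"
    unfolding bil_def by (intro sum.cong refl) (auto simp: axis_def)
  also have "\<dots> = (\<Sum>d\<in>UNIV - {a}. if d = b then 1 else 0)"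
    by (simp add: axis_def)
  also have "\<dots> = (if a = b then 0 else 1)"
    by auto
  finally show ?thesis .
qed

abbreviation cl_gen :: "'n::finite option \<Rightarrow> 'n cl" where
  "cl_gen a \<equiv> cl_vec (axis a 1)"

lemma cl_gen_swap: "a \<noteq> b \<Longrightarrow> cl_gen a * cl_gen b = cl_gen b * cl_gen a + 1"
proof -
  assume "a \<noteq> b"
  then have "cl_gen a * cl_gen b + cl_gen b * cl_gen a = 1"
    by (simp add: cl_vec_anticommute bil_axis cl_scalar_1)
  moreover have "cl_gen a * cl_gen b
      = cl_gen b * cl_gen a + (cl_gen a * cl_gen b + cl_gen b * cl_gen a)"
    by (simp only: add_ac cl_add_self add_0_right add_0)
  ultimately show ?thesis
    by simp
qed

lemma cl_gen_abs: "cl_gen a = abs_cl (Poly_Mapping.single (Letters [a]) 1)"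
proof -
  have "tensor_vec (axis a 1) = (\<Sum>b\<in>UNIV. if b = a then Poly_Mapping.single (Letters [a]) 1 else 0)"
    unfolding tensor_vec_def by (intro sum.cong refl) (auto simp: axis_def)
  then show ?thesis
    by (simp add: cl_vec.abs_eq)
qed

lemma cl_induct [case_names scalar gen add]:
  assumes scalar: "\<And>a. P (cl_scalar a)"
    and gen: "\<And>a c. P c \<Longrightarrow> P (cl_gen a * c)"
    and add: "\<And>c d. P c \<Longrightarrow> P d \<Longrightarrow> P (c + d)"
  shows "P (c :: 'n::finite cl)"
proof -
  have word: "P (abs_cl (Poly_Mapping.single (Letters ws) c))" for ws c
  proof (induction ws)
    case Nil
    then show ?case
      using scalar [of c] by (simp add: cl_scalar.abs_eq tensor_scalar_def zero_letters_def)
  next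
    case (Cons a ws)
    have "abs_cl (Poly_Mapping.single (Letters (a # ws)) c)
        = cl_gen a * abs_cl (Poly_Mapping.single (Letters ws) c)"
      by (simp add: cl_gen_abs times_cl.abs_eq mult_single plus_letters_def)
    then show ?case
      using gen [OF Cons] by simp
  qed
  have "P (abs_cl p)" for p :: "'n tensor"
  proof (induction p rule: tensor_induct)
    case zero
    then show ?case
      using scalar [of 0] by (simp only: cl_scalar_0) (simp add: zero_cl_def)
  next
    case (single w c)
    then show ?case
      using word [of "unletters w" c] by simp
  next
    case (add p p')
    then show ?case
      using assms(3) [OF add] by (simp add: plus_cl.abs_eq)
  qed
  then show ?thesis
    by (rule cl.abs_induct)
qed

definition ordered_prod :: "'n::finite option set \<Rightarrow> 'n cl" where
  "ordered_prod A = prod_list (map (\<lambda>k. cl_gen (inv_into UNIV rank k)) (sorted_list_of_set (rank ` A)))"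

lemma ordered_prod_empty: "ordered_prod {} = 1"
  by (simp add: ordered_prod_def)

lemma ordered_prod_insert:
  assumes "\<And>b. b \<in> A \<Longrightarrow> rank a < rank b"
  shows "ordered_prod (insert a A) = cl_gen a * ordered_prod A"
proof -
  have "Min (insert (rank a) (rank ` A)) = rank a"
    using assms by (intro Min_eqI) (auto simp: less_imp_le)
  moreover have "insert (rank a) (rank ` A) - {rank a} = rank ` A"
    using assms by (force simp: rank_eq_iff)
  ultimately have "sorted_list_of_set (rank ` insert a A) = rank a # sorted_list_of_set (rank ` A)"
    using sorted_list_of_set_nonempty [of "insert (rank a) (rank ` A)"] by simp
  then show ?thesis
    by (simp add: ordered_prod_def inv_f_f [OF inj_rank])
qed

text \<open>The factor \<open>e\<^sub>a\<close> is moved to the right past the factors \<open>e\<^sub>b\<close> of smaller rank. Each of these steps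
  leaves behind the product without \<open>e\<^sub>b\<close>. The factor ends at its place in the product,
  or it meets a second \<open>e\<^sub>a\<close> and the two are replaced by \<open>q(e\<^sub>a)\<close>. The formula agrees with the
  action on the exterior algebra in \<open>lmult_axis\<close>.\<close>

lemma cl_gen_ordered_prod:
  fixes a :: "'n::finite option"
  shows "cl_gen a * ordered_prod A = (if a \<in> A then 0 else ordered_prod (insert a A))
      + (\<Sum>b\<in>A. cl_scalar (half_form a b) * ordered_prod (A - {b}))"
proof -
  have "finite A" by simp
  then show ?thesis
  proof (induction A rule: finite_ranking_induct [where f = "\<lambda>b. - int (rank b)"])
    case empty
    then show ?case
      using ordered_prod_insert [of "{}" a] by simp
  next
    case (insert b A)
    (* The rank is negated, so b is the index of least rank, that is, the leftmost factor. *)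
    show ?case
    proof (cases "b \<in> A")
      case True
      then show ?thesis
        using insert.IH by (simp add: insert_absorb)
    next
      case False
      have less: "rank b < rank c" if "c \<in> A" for c
        using insert.hyps(2) [OF that] False that rank_eq_iff [of b c]
        by (metis le_neq_implies_less neg_le_iff_le of_nat_le_iff)
      have prod_b: "ordered_prod (insert b A) = cl_gen b * ordered_prod A"
        using less by (rule ordered_prod_insert)
      have remove: "insert b A - {c} = insert b (A - {c})" if "c \<in> A" for c
        using that False by auto
      have sum_remove: "(\<Sum>c\<in>A. cl_scalar (half_form a c) * ordered_prod (insert b A - {c}))
          = cl_gen b * (\<Sum>c\<in>A. cl_scalar (half_form a c) * ordered_prod (A - {c}))"
      proof -
        have "cl_scalar (half_form a c) * ordered_prod (insert b A - {c})
            = cl_gen b * (cl_scalar (half_form a c) * ordered_prod (A - {c}))" if "c \<in> A" for c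
        proof -
          have "ordered_prod (insert b A - {c}) = cl_gen b * ordered_prod (A - {c})"
            unfolding remove [OF that] using less by (intro ordered_prod_insert) auto
          then show ?thesis
            by (metis cl_scalar_commute mult.assoc)
        qed
        then show ?thesis
          by (simp add: sum_distrib_left)
      qed
      have split: "(\<Sum>c\<in>insert b A. cl_scalar (half_form a c) * ordered_prod (insert b A - {c}))
          = cl_scalar (half_form a b) * ordered_prod A
            + cl_gen b * (\<Sum>c\<in>A. cl_scalar (half_form a c) * ordered_prod (A - {c}))"
        using False sum_remove by simp
      consider "a = b" | "rank a < rank b" | "rank b < rank a"
        using rank_eq_iff [of a b] by linarith
      then show ?thesis
      proof cases
        case 1
        have "cl_scalar (half_form a c) = (0 :: 'n cl)" if "c \<in> A" for c
          using less [OF that] that False 1 by (auto simp: half_form_def cl_scalar_0)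
        then have "cl_gen b * (\<Sum>c\<in>A. cl_scalar (half_form a c) * ordered_prod (A - {c})) = 0"
          by simp
        then show ?thesis
          unfolding split
          using 1 by (simp add: prod_b mult.assoc [symmetric] cl_vec_square half_form_self)
      next
        case 2
        have "cl_scalar (half_form a c) = (0 :: 'n cl)" if "c \<in> insert b A" for c
          using less [of c] that 2 by (auto simp: half_form_def cl_scalar_0)
        then have "(\<Sum>c\<in>insert b A. cl_scalar (half_form a c) * ordered_prod (insert b A - {c})) = 0"
          by (intro sum.neutral) simp
        moreover have "a \<notin> insert b A"
          using less [of a] 2 by auto
        moreover have "ordered_prod (insert a (insert b A)) = cl_gen a * ordered_prod (insert b A)"
          using less 2 by (intro ordered_prod_insert) (auto intro: less_trans)
        ultimately show ?thesis
          by (simp only: if_False add_0_right)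
      next
        case 3
        then have ab: "a \<noteq> b" by auto
        have "ordered_prod (insert b (insert a A)) = cl_gen b * ordered_prod (insert a A)"
          using less 3 by (intro ordered_prod_insert) auto
        then have first: "cl_gen b * (if a \<in> A then 0 else ordered_prod (insert a A))
            = (if a \<in> insert b A then 0 else ordered_prod (insert a (insert b A)))"
          using ab by (simp add: insert_commute)
        have "cl_gen a * ordered_prod (insert b A)
            = cl_gen b * (cl_gen a * ordered_prod A) + ordered_prod A"
          by (simp only: prod_b mult.assoc [symmetric] cl_gen_swap [OF ab] distrib_right mult_1)
        also have "\<dots> = (if a \<in> insert b A then 0 else ordered_prod (insert a (insert b A)))
            + (cl_gen b * (\<Sum>c\<in>A. cl_scalar (half_form a c) * ordered_prod (A - {c}))
              + ordered_prod A)"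
          by (simp only: insert.IH distrib_left first add.assoc)
        also have "ordered_prod A = cl_scalar (half_form a b) * ordered_prod A"
          using 3 ab by (simp add: half_form_def cl_scalar_1)
        finally show ?thesis
          unfolding split by (simp only: add.commute)
      qed
    qed
  qed
qed

text \<open>The usual name for the linear map from the exterior algebra to the Clifford algebra that sends a wedge
  product of basis vectors to their ordered product.\<close>

definition quantize :: "'n::finite option ext \<Rightarrow> 'n cl" where
  "quantize f = (\<Sum>A\<in>UNIV. cl_scalar (f $ A) * ordered_prod A)"

lemma quantize_add: "quantize (f + g) = quantize f + quantize g"
  by (simp add: quantize_def cl_scalar_add distrib_right sum.distrib)

lemma quantize_scale: "quantize (c *s f) = cl_scalar c * quantize f"
  by (simp add: quantize_def cl_scalar_mult sum_distrib_left mult.assoc)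

lemma quantize_0: "quantize 0 = 0"
  by (simp add: quantize_def cl_scalar_0)

lemma quantize_sum: "quantize (sum f S) = (\<Sum>x\<in>S. quantize (f x))"
  by (induction S rule: infinite_finite_induct) (simp_all add: quantize_add quantize_0)

lemma quantize_axis: "quantize (axis A 1) = ordered_prod A"
proof -
  have "quantize (axis A 1) = (\<Sum>X\<in>UNIV. if X = A then ordered_prod X else 0)"
    unfolding quantize_def
    by (intro sum.cong refl) (auto simp: axis_def cl_scalar_0 cl_scalar_1)
  then show ?thesis by simp
qed

lemma lmult_axis:
  "lmult a (axis A 1) = (if a \<in> A then 0 else axis (insert a A) 1)
      + (\<Sum>b\<in>A. half_form a b *s axis (A - {b}) 1)"
proof -
  have "wedge a (axis A 1) = (if a \<in> A then 0 else axis (insert a A) 1)"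
    by (auto simp: wedge_def vec_eq_iff axis_def)
  moreover have "contract1 b (axis A 1) = (if b \<in> A then axis (A - {b}) 1 else 0)" for b
    by (auto simp: contract1_def vec_eq_iff axis_def)
  then have "contract (half_form a) (axis A 1)
      = (\<Sum>b\<in>UNIV. if b \<in> A then half_form a b *s axis (A - {b}) 1 else 0)"
    unfolding contract_def by (intro sum.cong refl) simp
  ultimately show ?thesis
    by (simp add: lmult_def mult_op_def sum.If_cases)
qed

lemma quantize_lmult: "quantize (lmult a f) = cl_gen a * quantize f"
proof -
  have axis: "quantize (lmult a (axis A 1)) = cl_gen a * quantize (axis A 1)" for A
    by (simp add: lmult_axis quantize_add quantize_0 quantize_axis quantize_sum quantize_scale
        cl_gen_ordered_prod)
  have "quantize (lmult a (\<Sum>A\<in>UNIV. f $ A *s axis A 1))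
      = cl_gen a * quantize (\<Sum>A\<in>UNIV. f $ A *s axis A 1)"
    by (simp add: lmult_def mult_op_sum mult_op_scale axis [unfolded lmult_def] quantize_sum
        quantize_scale sum_distrib_left cl_scalar_commute mult.assoc [symmetric])
      (simp add: mult.assoc cl_scalar_commute)
  then show ?thesis
    by (simp only: basis_expansion)
qed

lemma cl_act_gen: "cl_act (cl_gen a) f = lmult a f"
proof -
  have "cl_act (cl_gen a) f = (\<Sum>b\<in>UNIV. if b = a then lmult b f else 0)"
    unfolding cl_act_vec by (intro sum.cong refl) (auto simp: axis_def)
  then show ?thesis by simp
qed

lemma quantize_cl_act: "quantize (cl_act c f) = c * quantize f"
  by (induction c arbitrary: f rule: cl_induct)
    (simp_all add: cl_act_scalar quantize_scale cl_act_mult cl_act_gen quantize_lmult mult.assoc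
      cl_act_plus quantize_add distrib_right)

text \<open>The inverse of \<open>quantize\<close>. Only the injectivity matters below: it turns equations in the Clifford
  algebra into equations between coefficients.\<close>

definition symbol :: "'n::finite cl \<Rightarrow> 'n option ext" where
  "symbol c = cl_act c (axis {} 1)"

lemma quantize_symbol: "quantize (symbol c) = c"
  by (simp add: symbol_def quantize_cl_act quantize_axis ordered_prod_empty)

lemma symbol_inject: "symbol c = symbol d \<longleftrightarrow> c = d"
  by (metis quantize_symbol)

lemma symbol_plus: "symbol (c + d) = symbol c + symbol d"
  by (simp add: symbol_def cl_act_plus)

lemma symbol_scalar: "symbol (cl_scalar a) = a *s axis {} 1"
  by (simp add: symbol_def cl_act_scalar)

lemma symbol_one: "symbol 1 = axis {} 1"
  using symbol_scalar [of 1] by (simp add: cl_scalar_1)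

lemma symbol_scalar_mult: "symbol (cl_scalar a * c) = a *s symbol c"
  by (simp add: symbol_def cl_act_mult cl_act_scalar)

lemma symbol_vec: "symbol (cl_vec x) = (\<Sum>a\<in>UNIV. x $ a *s axis {a} 1)"
  by (simp add: symbol_def cl_act_vec lmult_def mult_op_axis_empty)

lemma symbol_vec_nth: "symbol (cl_vec x) $ {a} = x $ a"
proof -
  have "symbol (cl_vec x) $ {a} = (\<Sum>b\<in>UNIV. if b = a then x $ b else 0)"
    unfolding symbol_vec sum_component by (intro sum.cong refl) (auto simp: axis_def)
  then show ?thesis by simp
qed

lemma inj_cl_vec: "inj cl_vec"
  by (rule injI) (metis symbol_vec_nth vec_eq_iff)

lemma cl_scalar_inject: "cl_scalar a = cl_scalar b \<longleftrightarrow> a = b"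
proof
  assume "cl_scalar a = (cl_scalar b :: 'n::finite cl)"
  then have "symbol (cl_scalar a :: 'n cl) $ {} = symbol (cl_scalar b :: 'n cl) $ {}"
    by simp
  then show "a = b"
    by (simp add: symbol_scalar)
qed simp

section \<open>The centre of the Clifford algebra\<close>

text \<open>Left multiplications commute with right multiplications, so \<open>rmult\<close> is linear over the Clifford
  algebra and is therefore determined by its value at the unit of the exterior algebra.\<close>

lemma rmult_cl_act: "rmult a (cl_act c f) = cl_act c (rmult a f)"
  by (induction c arbitrary: f rule: cl_induct)
    (simp_all add: cl_act_scalar cl_act_mult cl_act_gen cl_act_plus rmult_lmult
      rmult_def [of a, THEN fun_cong] mult_op_scale mult_op_add)

lemma symbol_gen_left: "symbol (cl_gen a * c) = lmult a (symbol c)"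
  by (simp add: symbol_def cl_act_mult cl_act_gen)

lemma symbol_gen_right: "symbol (c * cl_gen a) = rmult a (symbol c)"
proof -
  have "lmult a (axis {} 1) = rmult a (axis {} 1)"
    by (simp add: lmult_def rmult_def mult_op_axis_empty)
  then show ?thesis
    by (simp add: symbol_def cl_act_mult cl_act_gen rmult_cl_act)
qed

text \<open>In the difference of left and right multiplication by \<open>e\<^sub>a\<close> the wedge products cancel. What remains is
  the contraction with the form \<open>(e\<^sub>a,-)\<close>, which takes the value \<open>1\<close> on all basis vectors except \<open>e\<^sub>a\<close>.\<close>

lemma contract1_symbol_commuting:
  assumes "cl_gen a * c = c * cl_gen a"
  shows "contract1 a (symbol c) = (\<Sum>b\<in>UNIV. contract1 b (symbol c))"
proof -
  let ?f = "symbol c"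
  have "lmult a ?f = rmult a ?f"
    using arg_cong [OF assms, of symbol] by (simp only: symbol_gen_left symbol_gen_right)
  then have "contract (half_form a) ?f = contract (\<lambda>b. half_form b a) ?f"
    by (simp add: lmult_def rmult_def mult_op_def)
  then have "0 = contract (\<lambda>b. half_form a b + half_form b a) ?f"
    by (simp add: contract_plus)
  also have "\<dots> = (\<Sum>b\<in>UNIV. if b = a then 0 else contract1 b ?f)"
    unfolding contract_def by (intro sum.cong refl) (auto simp: half_form_add_flip)
  also have "\<dots> = (\<Sum>b\<in>UNIV - {a}. contract1 b ?f)"
    by (simp add: sum.remove [of UNIV a] cong: sum.cong_simp)
  finally show ?thesis
    by (simp add: sum.remove [of UNIV a])
qed

definition radical_vec :: "'n::finite V" where
  "radical_vec = vec_u + (\<Sum>i\<in>UNIV. vec_v i)"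

lemma radical_vec_nth: "radical_vec $ a = 1"
proof -
  have "(\<Sum>i\<in>UNIV. vec_v i $ a) = (\<Sum>i\<in>UNIV. if a = Some i then 1 else 0 :: laurent)"
    by (intro sum.cong refl) (simp add: vec_v_def axis_def)
  then show ?thesis
    by (cases a) (simp_all add: radical_vec_def vec_u_def axis_def)
qed

text \<open>By the preceding lemma the contractions of the symbol with all basis vectors coincide. Their common
  value \<open>D\<close> is annihilated by all contractions, which square to zero, and so it is a scalar. Hence the symbol has
  no coefficients at sets with more than one element, and all coefficients at singletons are equal.\<close>

lemma central_imp_scalar_plus_radical:
  assumes central: "\<And>x. cl_vec x * c = c * cl_vec x"
  obtains \<alpha> \<beta> where "c = cl_scalar \<alpha> + cl_scalar \<beta> * cl_vec radical_vec"
proof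
  let ?f = "symbol c"
  define D where "D = (\<Sum>b\<in>UNIV. contract1 b ?f)"
  have contract1: "contract1 a ?f = D" for a
    unfolding D_def using central by (rule contract1_symbol_commuting)
  have nth: "?f $ A = contract1 a ?f $ (A - {a})" if "a \<in> A" for a A
    using that by (simp add: contract1_def insert_absorb)
  have singleton: "?f $ {a} = D $ {}" for a
    using nth [of a "{a}"] by (simp add: contract1)
  have large: "?f $ A = 0" if A: "A \<noteq> {}" "\<And>a. A \<noteq> {a}" for A
  proof -
    obtain a where a: "a \<in> A" using A(1) by blast
    then obtain b where b: "b \<in> A - {a}"
      using A(2) [of a] by blast
    have "?f $ A = contract1 b ?f $ (A - {a})"
      using a by (simp add: nth contract1)
    then show ?thesis
      using b by (simp add: contract1_def)
  qed
  have "symbol (cl_scalar (?f $ {}) + cl_scalar (D $ {}) * cl_vec radical_vec) = ?f"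
    (is "?lhs = _")
  proof (subst vec_eq_iff, intro allI)
    fix A
    have lhs: "?lhs $ A = (if A = {} then ?f $ {} else 0)
        + D $ {} * (\<Sum>a\<in>UNIV. axis {a} 1 $ A)"
      by (simp add: symbol_plus symbol_scalar symbol_scalar_mult symbol_vec radical_vec_nth)
        (simp add: axis_def)
    show "?lhs $ A = ?f $ A"
    proof (cases "A = {}")
      case True
      then show ?thesis
        unfolding lhs by (simp add: axis_def)
    next
      case False
      show ?thesis
      proof (cases "\<exists>a. A = {a}")
        case True
        then obtain a where A: "A = {a}" by blast
        have "(\<Sum>b\<in>UNIV. axis {b} 1 $ A) = (\<Sum>b\<in>UNIV. if b = a then 1 else 0 :: laurent)"
          by (intro sum.cong refl) (auto simp: A axis_def)
        then show ?thesis
          unfolding lhs by (simp add: A singleton)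
      next
        case False
        then have "(\<Sum>b\<in>UNIV. axis {b} 1 $ A) = (0 :: laurent)"
          by (intro sum.neutral) (auto simp: axis_def)
        then show ?thesis
          unfolding lhs using \<open>A \<noteq> {}\<close> False large [of A] by simp
      qed
    qed
  qed
  then show "c = cl_scalar (?f $ {}) + cl_scalar (D $ {}) * cl_vec radical_vec"
    by (simp only: symbol_inject)
qed

lemma bil_radical_vec:
  assumes "even CARD('n)"
  shows "bil x (radical_vec :: 'n::finite V) = 0"
proof -
  have "bil x radical_vec = (\<Sum>a\<in>UNIV. of_nat CARD('n) * x $ a)"
    unfolding bil_def by (intro sum.cong refl) (simp add: radical_vec_nth)
  then show ?thesis
    using assms by (simp add: laurent_of_nat)
qed

lemma cl_vec_radical_commute:
  assumes "even CARD('n)"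
  shows "cl_vec x * cl_vec radical_vec = cl_vec radical_vec * cl_vec (x :: 'n::finite V)"
  using cl_vec_anticommute [of x radical_vec]
  by (simp add: bil_radical_vec [OF assms] cl_scalar_0 cl_add_eq_0_iff)

lemma q_radical_vec:
  assumes "even CARD('n)"
  shows "q (radical_vec :: 'n::finite V) = (if CARD('n) mod 4 = 0 then 1 else 0)"
proof -
  have "(\<Sum>a\<in>UNIV. (case a of None \<Rightarrow> 1 | Some (i :: 'n) \<Rightarrow> lp_t_inv) * (radical_vec $ a)\<^sup>2)
      = 1 + of_nat CARD('n) * lp_t_inv"
    by (simp add: radical_vec_nth UNIV_option_conv sum.reindex)
  moreover have "(\<Sum>A\<in>{A. card A = 2}. \<Prod>a\<in>A. (radical_vec :: 'n V) $ a)
      = of_nat (Suc CARD('n) choose 2)"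
    using n_subsets [of "UNIV :: 'n option set" 2] by (simp add: radical_vec_nth)
  moreover have "even (Suc CARD('n) choose 2) \<longleftrightarrow> CARD('n) mod 4 = 0"
  proof -
    obtain k where k: "CARD('n) = 2 * k" using assms by blast
    then have "Suc CARD('n) choose 2 = Suc (2 * k) * k"
      by (simp add: choose_two)
    then have "even (Suc CARD('n) choose 2) \<longleftrightarrow> even k"
      by simp
    also have "\<dots> \<longleftrightarrow> CARD('n) mod 4 = 0"
      unfolding k by presburger
    finally show ?thesis .
  qed
  ultimately show ?thesis
    using assms by (simp add: q_def laurent_of_nat)
qed

section \<open>Even elements\<close>

text \<open>Both the wedge product and the contraction with a basis vector change the parity of the degree.\<close>

lemma word_act_parity:
  fixes f :: "'n::finite option ext"
  assumes "\<And>A. odd (card A) \<Longrightarrow> f $ A = 0" and "even (card A) \<noteq> even (length (unletters w))"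
  shows "word_act w f $ A = 0"
proof -
  have "foldr lmult ws f $ A = 0" if "even (card A) \<noteq> even (length ws)" for ws A
    using that
  proof (induction ws arbitrary: A)
    case Nil
    then show ?case using assms(1) by simp
  next
    case (Cons a ws)
    let ?g = "foldr lmult ws f"
    have left: "?g $ (A - {a}) = 0" if "a \<in> A"
      using Cons.prems that card_Suc_Diff1 [of A a]
      by (intro Cons.IH) (metis even_Suc finite length_Cons)
    have right: "?g $ insert b A = 0" if "b \<notin> A" for b
      using Cons.prems that by (intro Cons.IH) simp
    have "lmult a ?g $ A = (if a \<in> A then ?g $ (A - {a}) else 0)
        + (\<Sum>b\<in>UNIV. half_form a b * (if b \<in> A then 0 else ?g $ insert b A))"
      by (simp add: lmult_def mult_op_def wedge_def contract_def contract1_def)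
    also have "\<dots> = 0 + (\<Sum>b\<in>(UNIV :: 'n option set). 0)"
      by (intro arg_cong2 [where f = "(+)"] sum.cong refl) (simp_all add: left right)
    finally show ?case
      by simp
  qed
  then show ?thesis
    using assms(2) by (simp add: word_act_def)
qed

lemma symbol_even:
  assumes "c \<in> cl_even" "odd (card A)"
  shows "symbol c $ A = 0"
proof -
  obtain p where c: "c = abs_cl p" and p: "p \<in> tensor_even"
    using assms(1) by (auto simp: cl_even_def)
  have "word_act w (axis {} 1) $ A = 0" if "w \<in> Poly_Mapping.keys p" for w
    using p that assms(2) by (intro word_act_parity) (auto simp: tensor_even_def axis_def)
  then show ?thesis
    by (simp add: c symbol_def cl_act.abs_eq tensor_act_def)
qed

lemma cl_even_mult:
  fixes c d :: "'n::finite cl"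
  shows "c \<in> cl_even \<Longrightarrow> d \<in> cl_even \<Longrightarrow> c * d \<in> cl_even"
proof -
  have "p * p' \<in> tensor_even" if "p \<in> tensor_even" "p' \<in> tensor_even" for p p' :: "'n tensor"
    using that Poly_Mapping.keys_mult [of p p']
    by (fastforce simp: tensor_even_def plus_letters_def)
  then show "c \<in> cl_even \<Longrightarrow> d \<in> cl_even \<Longrightarrow> c * d \<in> cl_even"
    by (auto simp: cl_even_def times_cl.abs_eq)
qed

lemma cl_even_conj:
  fixes c :: "'n::finite cl"
  shows "c \<in> cl_even \<Longrightarrow> cl_conj c \<in> cl_even"
proof -
  have "tensor_rev p \<in> tensor_even" if "p \<in> tensor_even" for p :: "'n tensor"
    unfolding tensor_even_def
  proof (intro CollectI ballI)
    fix w assume "w \<in> Poly_Mapping.keys (tensor_rev p)"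
    then have "rev_letters w \<in> Poly_Mapping.keys p"
      by (simp add: in_keys_iff lookup_tensor_rev)
    then show "even (length (unletters w))"
      using that by (force simp: tensor_even_def rev_letters_def)
  qed
  then show "c \<in> cl_even \<Longrightarrow> cl_conj c \<in> cl_even"
    by (auto simp: cl_even_def cl_conj.abs_eq)
qed

section \<open>The kernel of the action\<close>

lemma cl_monoid_simps:
  "carrier cl_monoid = UNIV" "x \<otimes>\<^bsub>cl_monoid\<^esub> y = x * y" "\<one>\<^bsub>cl_monoid\<^esub> = 1"
  by (simp_all add: cl_monoid_def)

lemma monoid_cl_monoid: "monoid cl_monoid"
  by (rule monoidI) (simp_all add: cl_monoid_simps mult.assoc)

lemma Units_cl_monoid: "c \<in> Units cl_monoid \<longleftrightarrow> (\<exists>d. d * c = 1 \<and> c * d = 1)"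
  by (auto simp: Units_def cl_monoid_simps)

lemma inv_cl_monoid: "c * d = 1 \<Longrightarrow> d * c = 1 \<Longrightarrow> inv\<^bsub>cl_monoid\<^esub> c = d"
  using monoid.inv_unique' [OF monoid_cl_monoid, of c d] by (simp add: cl_monoid_simps)

lemma cl_conj_conj: "cl_conj (cl_conj c) = c"
proof transfer
  fix p :: "'b::finite tensor"
  have "tensor_rev (tensor_rev p) = p"
    by (rule poly_mapping_eqI) (simp add: lookup_tensor_rev)
  then show "clifford_rel (tensor_rev (tensor_rev p)) p"
    by (simp add: cl_rel_refl)
qed

lemma Pin_conj:
  assumes "c \<in> Pin"
  shows "c * cl_conj c = 1" "cl_conj c * c = 1"
proof -
  show right: "c * cl_conj c = 1"
    using assms by (simp add: Pin_def)
  obtain d where "d * c = 1"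
    using assms by (auto simp: Pin_def clifford_group_def Units_cl_monoid)
  then have "d = cl_conj c"
    by (metis right mult.assoc mult_1 mult_1_right)
  with \<open>d * c = 1\<close> show "cl_conj c * c = 1" by simp
qed

lemma cl_vec_cl_pi:
  assumes "c \<in> Pin"
  shows "cl_vec (cl_pi c v) = cl_conj c * cl_vec v * c"
proof -
  have inv: "inv\<^bsub>cl_monoid\<^esub> c = cl_conj c"
    using Pin_conj [OF assms] by (rule inv_cl_monoid)
  then have "cl_conj c * cl_vec v * c \<in> range cl_vec"
    using assms by (auto simp: Pin_def clifford_group_def)
  then show ?thesis
    by (simp add: cl_pi_def inv f_the_inv_into_f inj_cl_vec)
qed

text \<open>The case \<open>d = 1\<close> describes the kernel. The general case lets the injectivity on \<open>Spin\<close> be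
  read off from the quotient of two elements with the same image.\<close>

lemma cl_pi_eq_imp_central:
  assumes "c \<in> Pin" "d \<in> Pin" "cl_pi c = cl_pi d"
  shows "cl_vec v * (c * cl_conj d) = (c * cl_conj d) * cl_vec v"
proof -
  have eq: "cl_conj c * cl_vec v * c = cl_conj d * cl_vec v * d"
    using assms cl_vec_cl_pi by metis
  have "cl_vec v * (c * cl_conj d) = (c * cl_conj c) * (cl_vec v * (c * cl_conj d))"
    using Pin_conj(1) [OF assms(1)] by simp
  also have "\<dots> = c * (cl_conj c * cl_vec v * c) * cl_conj d"
    by (simp only: mult.assoc)
  also have "\<dots> = c * cl_conj d * cl_vec v * (d * cl_conj d)"
    unfolding eq by (simp only: mult.assoc)
  finally show ?thesis
    using Pin_conj(1) [OF assms(2)] by simp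
qed

lemma central_involution_in_Pin:
  assumes "\<And>v. cl_vec v * c = c * cl_vec v" "cl_conj c = c" "c * c = 1"
  shows "c \<in> Pin" "cl_pi c = id"
proof -
  have inv: "inv\<^bsub>cl_monoid\<^esub> c = c"
    using assms(3) by (intro inv_cl_monoid)
  have act: "c * cl_vec v * c = cl_vec v" for v
    by (metis assms(1,3) mult.assoc mult_1_right)
  show "c \<in> Pin"
    using assms act by (auto simp: Pin_def clifford_group_def Units_cl_monoid inv)
  show "cl_pi c = id"
    by (rule ext) (simp add: cl_pi_def inv act the_inv_f_f inj_cl_vec)
qed

lemma one_in_Pin: "1 \<in> Pin" and cl_pi_one: "cl_pi 1 = id"
  using central_involution_in_Pin [of 1] cl_conj_scalar [of 1] by (simp_all add: cl_scalar_1)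

lemma cl_conj_scalar_plus_radical:
  "cl_conj (cl_scalar \<alpha> + cl_scalar \<beta> * cl_vec x) = cl_scalar \<alpha> + cl_scalar \<beta> * cl_vec x"
  by (simp add: cl_conj_add cl_conj_mult cl_conj_scalar cl_conj_vec cl_scalar_commute)

lemma scalar_plus_vec_square:
  "(cl_scalar \<alpha> + cl_scalar \<beta> * cl_vec x) * (cl_scalar \<alpha> + cl_scalar \<beta> * cl_vec x)
    = cl_scalar (\<alpha> * \<alpha> + \<beta> * \<beta> * q x)"
proof -
  let ?x = "cl_scalar \<beta> * cl_vec x"
  have "?x * ?x = cl_scalar \<beta> * (cl_vec x * cl_scalar \<beta>) * cl_vec x"
    by (simp only: mult.assoc)
  also have "\<dots> = cl_scalar \<beta> * cl_scalar \<beta> * (cl_vec x * cl_vec x)"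
    by (simp only: cl_scalar_commute [of \<beta> "cl_vec x", symmetric] mult.assoc)
  finally have sq: "?x * ?x = cl_scalar (\<beta> * \<beta> * q x)"
    by (simp only: cl_vec_square cl_scalar_mult)
  have "(cl_scalar \<alpha> + ?x) * (cl_scalar \<alpha> + ?x)
      = cl_scalar \<alpha> * cl_scalar \<alpha> + ?x * ?x + (cl_scalar \<alpha> * ?x + ?x * cl_scalar \<alpha>)"
    by (simp only: distrib_left distrib_right add_ac)
  also have "\<dots> = cl_scalar \<alpha> * cl_scalar \<alpha> + ?x * ?x"
    by (simp only: cl_scalar_commute [of \<alpha> ?x] cl_add_self add_0_right)
  finally show ?thesis
    by (simp only: sq cl_scalar_mult cl_scalar_add)
qed

text \<open>The condition on the coefficients says \<open>c\<^sup>2 = 1\<close>, since the reversal fixes scalars and vectors.\<close>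

lemma kernel_Pin:
  assumes "even CARD('n)"
  shows "kernel clifford_group GO cl_pi \<inter> Pin
    = {cl_scalar \<alpha> + cl_scalar \<beta> * cl_vec (radical_vec :: 'n::finite V) | \<alpha> \<beta>.
        \<alpha> * \<alpha> + \<beta> * \<beta> * q (radical_vec :: 'n V) = 1}" (is "?K = ?S")
proof (intro equalityI subsetI)
  fix c :: "'n cl" assume "c \<in> ?K"
  then have c: "c \<in> Pin" "cl_pi c = cl_pi 1"
    by (auto simp: kernel_def GO_def cl_pi_one)
  have "cl_conj 1 = (1 :: 'n cl)"
    using cl_conj_scalar [of 1] by (simp add: cl_scalar_1)
  then have "cl_vec v * c = c * cl_vec v" for v
    using cl_pi_eq_imp_central [OF c(1) one_in_Pin c(2), of v] by simp
  then obtain \<alpha> \<beta> where eq: "c = cl_scalar \<alpha> + cl_scalar \<beta> * cl_vec radical_vec"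
    by (rule central_imp_scalar_plus_radical)
  have "cl_scalar (\<alpha> * \<alpha> + \<beta> * \<beta> * q (radical_vec :: 'n V)) = (cl_scalar 1 :: 'n cl)"
    using Pin_conj(1) [OF c(1)]
    unfolding eq cl_conj_scalar_plus_radical scalar_plus_vec_square cl_scalar_1 .
  then show "c \<in> ?S"
    using eq by (auto simp: cl_scalar_inject)
next
  fix c :: "'n cl" assume "c \<in> ?S"
  then obtain \<alpha> \<beta> where c: "c = cl_scalar \<alpha> + cl_scalar \<beta> * cl_vec radical_vec"
    and one: "\<alpha> * \<alpha> + \<beta> * \<beta> * q (radical_vec :: 'n V) = 1"
    by blast
  have "cl_vec v * (cl_scalar \<beta> * cl_vec radical_vec)
      = (cl_scalar \<beta> * cl_vec radical_vec) * cl_vec v" for v :: "'n V"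
    using cl_vec_radical_commute [OF assms, of v]
    by (metis cl_scalar_commute mult.assoc)
  then have central: "cl_vec v * c = c * cl_vec v" for v
    by (simp add: c distrib_left distrib_right cl_scalar_commute)
  have sq: "c * c = 1"
    by (simp only: c scalar_plus_vec_square one cl_scalar_1)
  have conj: "cl_conj c = c"
    by (simp only: c cl_conj_scalar_plus_radical)
  have "c \<in> Pin" "cl_pi c = id"
    using central_involution_in_Pin [OF central conj sq] .
  then show "c \<in> ?K"
    by (simp add: kernel_def GO_def Pin_def)
qed

text \<open>The quotient of two elements of \<open>Spin\<close> with the same image is central and even. Its
  coefficient at \<open>r\<close> is then zero, because the symbol of \<open>r\<close> has degree one; so the quotient is a scalar
  with square \<open>1\<close>.\<close>

lemma inj_on_Spin: "inj_on cl_pi (Spin :: 'n::finite cl set)"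
proof (rule inj_onI)
  fix c d :: "'n cl"
  assume "c \<in> Spin" "d \<in> Spin" and eq: "cl_pi c = cl_pi d"
  then have Pin: "c \<in> Pin" "d \<in> Pin" and even: "c \<in> cl_even" "d \<in> cl_even"
    by (auto simp: Spin_def)
  let ?z = "c * cl_conj d"
  have "cl_vec v * ?z = ?z * cl_vec v" for v
    using Pin eq by (rule cl_pi_eq_imp_central)
  then obtain \<alpha> \<beta> where z: "?z = cl_scalar \<alpha> + cl_scalar \<beta> * cl_vec radical_vec"
    by (rule central_imp_scalar_plus_radical)
  have "symbol ?z $ {None} = 0"
    using even by (intro symbol_even cl_even_mult cl_even_conj) simp_all
  then have "\<beta> = 0"
    unfolding z
    by (simp add: symbol_plus symbol_scalar symbol_scalar_mult symbol_vec_nth radical_vec_nth axis_def)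
  then have scalar: "?z = cl_scalar \<alpha>"
    using z by (simp add: cl_scalar_0)
  have "cl_scalar (\<alpha> * \<alpha>) = ?z * cl_conj ?z"
    by (simp only: scalar cl_conj_scalar cl_scalar_mult)
  also have "\<dots> = c * (cl_conj d * d) * cl_conj c"
    by (simp only: cl_conj_mult cl_conj_conj mult.assoc)
  also have "\<dots> = cl_scalar 1"
    by (simp add: Pin_conj Pin cl_scalar_1)
  finally have "\<alpha> = 1"
    by (simp add: cl_scalar_inject laurent_square_eq_1_iff)
  then have "?z * d = d"
    by (simp add: scalar cl_scalar_1)
  then show "c = d"
    using Pin_conj(2) [OF Pin(2)] by (simp add: mult.assoc)
qed

theorem corollary3p12:
  fixes m :: nat and r :: "'n::finite cl"
  assumes "m = CARD('n)" and "m \<ge> 2" and "even m"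
    and "r = cl_vec (vec_u + (\<Sum>i\<in>UNIV. vec_v i))"
  shows "\<not> inj_on cl_pi (Pin :: 'n cl set)
    \<and> (m mod 4 = 2 \<longrightarrow>
         kernel clifford_group GO cl_pi \<inter> Pin = {1 + cl_scalar l * r | l. True})
    \<and> (m mod 4 = 0 \<longrightarrow>
         kernel clifford_group GO cl_pi \<inter> Pin = {1 + cl_scalar l * (1 + r) | l. True})
    \<and> inj_on cl_pi (Spin :: 'n cl set)"
proof -
  have even: "even CARD('n)"
    using assms by simp
  have r: "r = cl_vec radical_vec"
    by (simp add: assms(4) radical_vec_def)
  let ?K = "kernel clifford_group GO cl_pi \<inter> (Pin :: 'n cl set)"
  let ?q = "q (radical_vec :: 'n V)"
  have kernel: "?K = {cl_scalar \<alpha> + cl_scalar \<beta> * r | \<alpha> \<beta>. \<alpha> * \<alpha> + \<beta> * \<beta> * ?q = 1}"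
    unfolding r by (rule kernel_Pin [OF even])
  have two: "?K = {1 + cl_scalar l * r | l. True}" if "m mod 4 = 2"
  proof -
    have "?q = 0"
      using q_radical_vec [OF even] that assms(1) by simp
    then show ?thesis
      unfolding kernel by (auto simp: laurent_square_eq_1_iff cl_scalar_1)
  qed
  have four: "?K = {1 + cl_scalar l * (1 + r) | l. True}" if "m mod 4 = 0"
  proof -
    have "?q = 1"
      using q_radical_vec [OF even] that assms(1) by simp
    moreover have "\<alpha> * \<alpha> + \<beta> * \<beta> = 1 \<longleftrightarrow> \<alpha> = 1 + \<beta>" for \<alpha> \<beta> :: laurent
    proof -
      have "(\<alpha> + \<beta>) * (\<alpha> + \<beta>) = \<alpha> * \<alpha> + \<beta> * \<beta> + (\<alpha> * \<beta> + \<alpha> * \<beta>)"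
        by (simp only: distrib_left distrib_right add_ac mult.commute)
      then have "\<alpha> * \<alpha> + \<beta> * \<beta> = (\<alpha> + \<beta>) * (\<alpha> + \<beta>)"
        by (simp only: lp_add_self add_0_right)
      then have "\<alpha> * \<alpha> + \<beta> * \<beta> = 1 \<longleftrightarrow> \<alpha> + \<beta> = 1"
        by (simp only: laurent_square_eq_1_iff)
      also have "\<dots> \<longleftrightarrow> \<alpha> = 1 + \<beta>"
        using laurent_add_eq_0_iff [of "\<alpha> + \<beta>" 1] laurent_add_eq_0_iff [of \<alpha> "1 + \<beta>"]
        by (simp only: add_ac)
      finally show ?thesis .
    qed
    moreover have "cl_scalar (1 + l) + cl_scalar l * r = 1 + cl_scalar l * (1 + r)" for l
      by (simp add: cl_scalar_add cl_scalar_1 distrib_left add.assoc)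
    ultimately show ?thesis
      unfolding kernel by (simp only: mult_1_right) metis
  qed
  have "\<not> inj_on cl_pi (Pin :: 'n cl set)"
  proof
    assume inj: "inj_on cl_pi (Pin :: 'n cl set)"
    (* The members with l = 1 of the two families in the kernel. *)
    define c where "c = (if m mod 4 = 0 then r else 1 + r)"
    have "c = cl_scalar (if m mod 4 = 0 then 0 else 1) + cl_scalar 1 * r"
      by (simp add: c_def cl_scalar_0 cl_scalar_1)
    moreover have "(if m mod 4 = 0 then 0 else 1) * (if m mod 4 = 0 then 0 else 1) + 1 * 1 * ?q = 1"
      using q_radical_vec [OF even] assms(1) by simp
    ultimately have "c \<in> ?K"
      unfolding kernel by blast
    then have "cl_pi c = cl_pi 1" "c \<in> Pin"
      by (auto simp: kernel_def GO_def cl_pi_one)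
    then have "c = 1"
      using inj one_in_Pin by (auto dest: inj_onD)
    then have "symbol c $ {None} = 0"
      by (simp add: symbol_one axis_def)
    moreover have "symbol c $ {None} = 1"
      by (simp add: c_def r symbol_plus symbol_vec_nth radical_vec_nth symbol_one axis_def)
    ultimately show False
      by simp
  qed
  then show ?thesis
    using two four inj_on_Spin by blast
qed

end
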